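(* Let $q\ge1$, let $T^{2q}=\mathbb{R}^{2q}/2\pi\mathbb{Z}^{2q}$ with coordinates $(x,y)=(x_1,\dots,x_q,y_1,\dots,y_q)$ and symplectic form $\omega=\sum_{i=1}^q dx_i\wedge dy_i$, and let $n,m,k,l\in\mathbb{Z}^q$ with $n^2+m^2\neq0$ and $k^2+l^2\neq0$. Let $F$ be one of the functions $\cos(nx+my)$, $\sin(nx+my)$ and let $H$ be one of the functions $\cos(kx+ly)$, $\sin(kx+ly)$, and suppose that the Hamiltonian vector fields $X_F,X_H$ span a 2-plane $\sigma$ (i.e. are linearly independent). Then the sectional curvature, in the direction $\sigma$, of the bi-invariant metric $\langle X_F,X_H\rangle_e=\int_{T^{2q}}FH\,d\mu$ on the group $\mathcal{D}_{\omega H}(T^{2q})$ of Hamiltonian transformations of the torus is $$ K_\sigma=\frac{(mk-nl)^2}{4(2\pi)^{2q}}. $$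
   Context: For $a,b\in\mathbb{Z}^q$ (or $\mathbb{R}^q$), $ab=\sum_{i=1}^q a_ib_i$ and $a^2=aa$; so $nx=\sum_i n_ix_i$, $mk=\sum_i m_ik_i$, etc. $d\mu$ is the Lebesgue measure $dx_1\cdots dx_q\,dy_1\cdots dy_q$ on $T^{2q}$, of total mass $(2\pi)^{2q}$. For a smooth function $F$ the Hamiltonian vector field $X_F$ is defined by $\omega(\cdot,X_F)=dF$; Hamiltonians are normalized by $\int F\,d\mu=0$. The Poisson bracket is $\{F,H\}=\omega(X_F,X_H)$ and $[X_F,X_H]=X_{\{F,H\}}$. $\mathcal{D}_{\omega H}(T^{2q})$ is the connected (ILH-)Lie group of Hamiltonian diffeomorphisms, whose Lie algebra is the space of smooth Hamiltonian vector fields with the Lie bracket of vector fields. The inner product $\langle X_F,X_H\rangle_e=\int FH\,d\mu$ on this Lie algebra is $\mathrm{Ad}$-invariant and hence defines a bi-invariant weak Riemannian metric on the group. Its Riemannian connection is determined on right-invariant vector fields (the bracket of the right-invariant fields defined by $X,Y$ being that defined by $[X,Y]$) by $\nabla^0_{X_F}X_H=\frac12[X_F,X_H]$. The curvature tensor is $R^0(X,Y)Z=\nabla^0_X\nabla^0_YZ-\nabla^0_Y\nabla^0_XZ-\nabla^0_{[X,Y]}Z$, and the sectional curvature of the plane $\sigma$ spanned by $X,Y$ is $$K_\sigma=\frac{\langle R^0(X,Y)Y,X\rangle_e}{\langle X,X\rangle_e\langle Y,Y\rangle_e-\langle X,Y\rangle_e^2}.$$ *)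

theory Defs
  imports "HOL-Analysis.Analysis"
begin

text \<open>
  Points of the universal cover of the torus are pairs \<open>(x, y)\<close> with \<open>x\<close>, \<open>y\<close> in
  \<open>real ^ 'q\<close>, where \<open>q = CARD('q)\<close>. Functions and vector fields on the torus are
  represented by their lifts, i.e. by \<open>2 pi\<close>-periodic functions on the cover.
\<close>

type_synonym 'q pt = "(real ^ 'q) \<times> (real ^ 'q)"

definition torus_periodic :: "('q::finite pt \<Rightarrow> 'b) \<Rightarrow> bool" where
  "torus_periodic f \<longleftrightarrow>
     (\<forall>(a :: int ^ 'q) (b :: int ^ 'q) x y.
        f (x + (\<chi> i. 2 * pi * of_int (a $ i)), y + (\<chi> i. 2 * pi * of_int (b $ i))) = f (x, y))"

primrec C_diff :: "nat \<Rightarrow> ('a::euclidean_space \<Rightarrow> 'b::euclidean_space) \<Rightarrow> bool" where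
  "C_diff 0 f \<longleftrightarrow> continuous_on UNIV f"
| "C_diff (Suc k) f \<longleftrightarrow>
     (\<forall>p. f differentiable at p) \<and> (\<forall>v. C_diff k (\<lambda>p. frechet_derivative f (at p) v))"

definition smooth :: "('a::euclidean_space \<Rightarrow> 'b::euclidean_space) \<Rightarrow> bool" where
  "smooth f \<longleftrightarrow> (\<forall>k. C_diff k f)"

definition torus_integral :: "('q::finite pt \<Rightarrow> real) \<Rightarrow> real" where
  "torus_integral f =
     set_lebesgue_integral lborel (cbox (0, 0) (\<chi> i. 2 * pi, \<chi> i. 2 * pi)) f"

definition sympl_form :: "'q::finite pt \<Rightarrow> 'q pt \<Rightarrow> real" where
  "sympl_form u v = (\<Sum>i\<in>UNIV. fst u $ i * snd v $ i - snd u $ i * fst v $ i)"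

definition ham_vf :: "('q::finite pt \<Rightarrow> real) \<Rightarrow> 'q pt \<Rightarrow> 'q pt" where
  "ham_vf F p = (THE w. \<forall>v. sympl_form v w = frechet_derivative F (at p) v)"

definition normalized_hamiltonian :: "('q::finite pt \<Rightarrow> real) \<Rightarrow> bool" where
  "normalized_hamiltonian F \<longleftrightarrow> smooth F \<and> torus_periodic F \<and> torus_integral F = 0"

text \<open>The Lie algebra of the group of Hamiltonian diffeomorphisms.\<close>

definition ham_fields :: "('q::finite pt \<Rightarrow> 'q pt) set" where
  "ham_fields = ham_vf ` {F. normalized_hamiltonian F}"

definition hamiltonian_of :: "('q::finite pt \<Rightarrow> 'q pt) \<Rightarrow> 'q pt \<Rightarrow> real" where
  "hamiltonian_of X = (THE F. normalized_hamiltonian F \<and> ham_vf F = X)"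

definition inner_e :: "('q::finite pt \<Rightarrow> 'q pt) \<Rightarrow> ('q pt \<Rightarrow> 'q pt) \<Rightarrow> real" where
  "inner_e X Y = torus_integral (\<lambda>p. hamiltonian_of X p * hamiltonian_of Y p)"

text \<open>
  The sign of the bracket is that of the commutator of derivations, so that the bracket of
  \<open>ham_vf F\<close> and \<open>ham_vf H\<close> has Hamiltonian \<open>\<lambda>p. sympl_form (ham_vf F p) (ham_vf H p)\<close>.
\<close>

definition lie_bracket ::
    "('a::real_normed_vector \<Rightarrow> 'a) \<Rightarrow> ('a \<Rightarrow> 'a) \<Rightarrow> 'a \<Rightarrow> 'a" where
  "lie_bracket X Y p =
     frechet_derivative Y (at p) (X p) - frechet_derivative X (at p) (Y p)"

text \<open>
  A right-invariant vector field on the group is represented by its value at the identity,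
  an element of \<open>ham_fields\<close>. The connection of the bi-invariant metric maps right-invariant
  fields to right-invariant fields, hence so does its curvature tensor.
\<close>

definition nabla0 :: "('q::finite pt \<Rightarrow> 'q pt) \<Rightarrow> ('q pt \<Rightarrow> 'q pt) \<Rightarrow> 'q pt \<Rightarrow> 'q pt" where
  "nabla0 X Y = (\<lambda>p. (1 / 2) *\<^sub>R lie_bracket X Y p)"

definition curvature0 ::
    "('q::finite pt \<Rightarrow> 'q pt) \<Rightarrow> ('q pt \<Rightarrow> 'q pt) \<Rightarrow> ('q pt \<Rightarrow> 'q pt) \<Rightarrow> 'q pt \<Rightarrow> 'q pt" where
  "curvature0 X Y Z =
     (\<lambda>p. nabla0 X (nabla0 Y Z) p - nabla0 Y (nabla0 X Z) p - nabla0 (lie_bracket X Y) Z p)"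

definition lin_indep :: "('a \<Rightarrow> 'b::real_vector) \<Rightarrow> ('a \<Rightarrow> 'b) \<Rightarrow> bool" where
  "lin_indep X Y \<longleftrightarrow>
     (\<forall>a b :: real. (\<forall>p. a *\<^sub>R X p + b *\<^sub>R Y p = 0) \<longrightarrow> a = 0 \<and> b = 0)"

definition span2 :: "('a \<Rightarrow> 'b::real_vector) \<Rightarrow> ('a \<Rightarrow> 'b) \<Rightarrow> ('a \<Rightarrow> 'b) set" where
  "span2 X Y = {\<lambda>p. a *\<^sub>R X p + b *\<^sub>R Y p | a b :: real. True}"

text \<open>
  The sectional curvature is a function of the plane, so its defining quotient has to take
  the same value for every basis \<open>X, Y\<close> of the plane.
\<close>

definition sectional_curvature :: "('q::finite pt \<Rightarrow> 'q pt) set \<Rightarrow> real" where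
  "sectional_curvature \<sigma> =
     (THE K. \<forall>X\<in>ham_fields. \<forall>Y\<in>ham_fields. lin_indep X Y \<and> span2 X Y = \<sigma> \<longrightarrow>
        K = inner_e (curvature0 X Y Y) X
              / (inner_e X X * inner_e Y Y - (inner_e X Y)\<^sup>2))"

definition zdot :: "int ^ 'q \<Rightarrow> int ^ 'q::finite \<Rightarrow> int" where
  "zdot a b = (\<Sum>i\<in>UNIV. a $ i * b $ i)"

definition phase :: "int ^ 'q \<Rightarrow> int ^ 'q \<Rightarrow> 'q::finite pt \<Rightarrow> real" where
  "phase n m p = (\<Sum>i\<in>UNIV. of_int (n $ i) * fst p $ i) + (\<Sum>i\<in>UNIV. of_int (m $ i) * snd p $ i)"

end

theory Submission
  imports Defs
begin

text \<open>
  Ad-invariance of the metric gives \<open>\<langle>R(X, Y) Y, X\<rangle> = 1/4 |[X, Y]|\<^sup>2\<close>, so for \<open>X = X\<^sub>F\<close>, \<open>Y = X\<^sub>H\<close> only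
  the \<open>L\<^sup>2\<close> norm of \<open>{F, H}\<close> is needed. All Hamiltonians that occur are trigonometric polynomials,
  a class closed under products and Poisson brackets. There \<open>\<integral>{f, g} d\<mu> = 0\<close> and
  \<open>[X\<^sub>f, X\<^sub>g] = X\<^bsub>{f, g}\<^esub>\<close> can be checked on pairs of harmonics \<open>cos (nx + my + s)\<close>, by bilinearity.
  For harmonics with frequencies \<open>(n, m)\<close> and \<open>(k, l)\<close> the bracket is \<open>(nl - mk)\<close> times a product of
  two sines, and \<open>nl - mk = 0\<close> whenever the frequencies agree up to sign, which is the only case in
  which the average of the squared product of sines is not 1/4.
\<close>

section \<open>Integrals of harmonics over the torus\<close>

text \<open>Fubini for functions that split over the coordinates: \<open>lborel\<close> is the image
  of the product of the one-dimensional measures under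
  \<open>\<Sum>b\<in>Basis. y b *\<^sub>R b\<close>.\<close>

lemma lborel_integral_prod:
  fixes f :: "'a::euclidean_space \<Rightarrow> real \<Rightarrow> 'b::{real_normed_field,banach,second_countable_topology}"
  assumes int: "\<And>b. b \<in> Basis \<Longrightarrow> integrable lborel (f b)"
  shows "(\<integral>x. (\<Prod>b\<in>Basis. f b (x \<bullet> b)) \<partial>lborel) = (\<Prod>b\<in>Basis. \<integral>t. f b t \<partial>lborel)"
proof -
  interpret product_sigma_finite "\<lambda>b::'a. lborel :: real measure"
    by unfold_locales
  have meas[measurable]: "f b \<in> borel_measurable borel" if "b \<in> Basis" for b
    using borel_measurable_integrable[OF int[OF that]] by simp
  have "(\<integral>x. (\<Prod>b\<in>Basis. f b (x \<bullet> b)) \<partial>lborel)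
      = (\<integral>y. (\<Prod>b\<in>Basis. f b ((\<Sum>b\<in>Basis. y b *\<^sub>R b) \<bullet> b)) \<partial>(\<Pi>\<^sub>M b\<in>(Basis::'a set). (lborel :: real measure)))"
    by (subst lborel_eq, subst integral_distr) auto
  also have "\<dots> = (\<integral>y. (\<Prod>b\<in>Basis. f b (y b)) \<partial>(\<Pi>\<^sub>M b\<in>(Basis::'a set). (lborel :: real measure)))"
    by simp
  also have "\<dots> = (\<Prod>b\<in>Basis. \<integral>t. f b t \<partial>lborel)"
    by (rule product_integral_prod) (auto simp: int)
  finally show ?thesis .
qed

text \<open>Orthogonality of characters: for \<open>j \<noteq> 0\<close> the antiderivative takes
  the same value at both ends of a full period.\<close>

lemma integral_cis_multiple:
  fixes j :: int
  shows "(\<integral>t. indicator {0..2 * pi} t *\<^sub>R cis (of_int j * t) \<partial>lborel)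
       = (if j = 0 then of_real (2 * pi) else 0)"
proof (cases "j = 0")
  case True
  have "(\<integral>t. indicator {0..2 * pi} t *\<^sub>R (1::complex) \<partial>lborel) = of_real (2 * pi) - of_real 0"
    by (rule integral_FTC_atLeastAtMost) (auto intro!: derivative_eq_intros simp: has_vector_derivative_def scaleR_conv_of_real)
  then show ?thesis
    using True by simp
next
  case False
  define g where "g t = cis (of_int j * t) / (\<i> * of_int j)" for t
  have "(\<integral>t. indicator {0..2 * pi} t *\<^sub>R cis (of_int j * t) \<partial>lborel) = g (2 * pi) - g 0"
  proof (rule integral_FTC_atLeastAtMost)
    \<comment> \<open>The antiderivative is differentiated as an entire function and then restricted
      to the real line.\<close>
    have "((\<lambda>z. exp (\<i> * (of_int j * z)) / (\<i> * of_int j)) has_field_derivative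
        exp (\<i> * (of_int j * of_real t))) (at (of_real t))" for t
      using False by (auto intro!: derivative_eq_intros simp: mult_ac)
    from has_vector_derivative_real_field[OF this]
    show "(g has_vector_derivative cis (of_int j * t)) (at t within {0..2 * pi})" for t
      by (simp add: g_def[abs_def] cis_conv_exp)
  qed (auto intro!: continuous_intros)
  also have "g (2 * pi) = g 0"
    by (simp add: g_def cis_conv_exp exp_eq_1 mult.commute)
  finally show ?thesis
    using False by simp
qed

text \<open>The pair of integer vectors becomes a point of the cover, so that a phase is an inner
  product and frequencies can be compared as vectors.\<close>

definition freq :: "int ^ 'q \<Rightarrow> int ^ 'q \<Rightarrow> 'q::finite pt" where
  "freq n m = (\<chi> i. of_int (n $ i), \<chi> i. of_int (m $ i))"

lemma phase_eq_inner: "phase n m p = freq n m \<bullet> p"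
  by (cases p) (simp add: phase_def freq_def inner_vec_def)

lemma freq_simps:
  "freq (n + k) (m + l) = freq n m + freq k l"
  "freq (n - k) (m - l) = freq n m - freq k l"
  "freq n m = 0 \<longleftrightarrow> n = 0 \<and> m = 0"
  by (auto simp: freq_def vec_eq_iff zero_prod_def)

lemma freq_inner_Basis_int:
  assumes "b \<in> Basis"
  shows "freq n m \<bullet> b \<in> \<int>"
  using assms by (auto simp: Basis_prod_def Basis_vec_def freq_def inner_axis)

text \<open>Over the box \<open>cis (u \<bullet> p)\<close> factors into one-dimensional characters
  with integer frequencies, so a single nonzero coordinate of \<open>u\<close> makes the whole
  integral vanish.\<close>

lemma torus_integral_cos_inner:
  fixes u :: "'q::finite pt"
  assumes "\<And>b. b \<in> Basis \<Longrightarrow> u \<bullet> b \<in> \<int>"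
  shows "torus_integral (\<lambda>p. cos (u \<bullet> p + s)) = (if u = 0 then (2 * pi) ^ (2 * CARD('q)) * cos s else 0)"
proof -
  define B where "B = cbox (0::'q pt) (\<chi> i. 2 * pi, \<chi> i. 2 * pi)"
  define f :: "'q pt \<Rightarrow> real \<Rightarrow> complex" where
    "f b t = indicator {0..2 * pi} t *\<^sub>R cis (u \<bullet> b * t)" for b t
  obtain j :: "'q pt \<Rightarrow> int" where j: "u \<bullet> b = of_int (j b)" if "b \<in> Basis" for b
    using assms unfolding Ints_def image_iff by metis
  have corner: "(\<chi> i. 2 * pi, \<chi> i. 2 * pi) \<bullet> b = 2 * pi" if "b \<in> (Basis :: 'q pt set)" for b
    using that by (auto simp: Basis_prod_def Basis_vec_def inner_axis)
  \<comment> \<open>Each factor carries the indicator of its own side, and outside the box at least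
    one factor is zero.\<close>
  have f_prod: "(\<Prod>b\<in>Basis. f b (x \<bullet> b)) = indicator B x *\<^sub>R cis (u \<bullet> x)" for x
  proof (cases "x \<in> B")
    case True
    then have "\<And>b. b \<in> Basis \<Longrightarrow> x \<bullet> b \<in> {0..2 * pi}"
      by (auto simp: B_def mem_box corner)
    then have "(\<Prod>b\<in>Basis. f b (x \<bullet> b)) = (\<Prod>b\<in>Basis. cis ((u \<bullet> b) * (x \<bullet> b)))"
      by (intro prod.cong) (auto simp: f_def)
    also have "\<dots> = cis (\<Sum>b\<in>Basis. (u \<bullet> b) * (x \<bullet> b))"
      by (simp add: cis_conv_exp sum_distrib_left exp_sum)
    finally show ?thesis
      using True by (simp add: euclidean_inner[of u x])
  next
    case False
    then obtain b where "b \<in> Basis" "x \<bullet> b \<notin> {0..2 * pi}"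
      by (auto simp: B_def mem_box corner)
    then show ?thesis
      using False by (auto intro!: prod_zero bexI[of _ b] simp: f_def)
  qed
  have int_f: "integrable lborel (f b)" if "b \<in> Basis" for b
    using borel_integrable_atLeastAtMost'[of 0 "2 * pi" "\<lambda>t. cis (u \<bullet> b * t)"]
    by (simp add: f_def[abs_def] set_integrable_def continuous_intros)
  have "(\<integral>x. indicator B x *\<^sub>R cis (u \<bullet> x) \<partial>lborel) = (\<integral>x. (\<Prod>b\<in>Basis. f b (x \<bullet> b)) \<partial>lborel)"
    by (simp only: f_prod)
  also have "\<dots> = (\<Prod>b\<in>Basis. \<integral>t. f b t \<partial>lborel)"
    by (rule lborel_integral_prod) (rule int_f)
  also have "\<dots> = (\<Prod>b\<in>(Basis :: 'q pt set). if j b = 0 then of_real (2 * pi) else 0)"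
  proof (rule prod.cong[OF refl])
    fix b :: "'q pt"
    assume "b \<in> Basis"
    show "(\<integral>t. f b t \<partial>lborel) = (if j b = 0 then of_real (2 * pi) else 0)"
      unfolding f_def j[OF \<open>b \<in> Basis\<close>] by (rule integral_cis_multiple)
  qed
  also have "\<dots> = (if u = 0 then of_real ((2 * pi) ^ (2 * CARD('q))) else 0)"
  proof (cases "u = 0")
    case True
    then have "j b = 0" if "b \<in> Basis" for b
      using j[OF that] by simp
    then have "(\<Prod>b\<in>(Basis :: 'q pt set). if j b = 0 then of_real (2 * pi) else 0)
        = (\<Prod>b\<in>(Basis :: 'q pt set). complex_of_real (2 * pi))"
      by (intro prod.cong) simp_all
    moreover have "card (Basis :: 'q pt set) = 2 * CARD('q)"
      by simp
    ultimately show ?thesis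
      using True by (simp only: prod_constant of_real_power if_True simp_thms)
  next
    case False
    then obtain b where b: "b \<in> Basis" "u \<bullet> b \<noteq> 0"
      using euclidean_all_zero_iff by blast
    then have "j b \<noteq> 0"
      using j[of b] by simp
    with b(1) have "(\<Prod>b\<in>(Basis :: 'q pt set). if j b = 0 then complex_of_real (2 * pi) else 0) = 0"
      by (intro prod_zero) auto
    then show ?thesis
      using False by simp
  qed
  finally have cis_int: "(\<integral>x. indicator B x *\<^sub>R cis (u \<bullet> x) \<partial>lborel)
     = (if u = 0 then of_real ((2 * pi) ^ (2 * CARD('q))) else 0)" .
  \<comment> \<open>The shift \<open>s\<close> is the constant factor \<open>cis s\<close>; the
    cosine is recovered as a real part.\<close>
  have "integrable lborel (\<lambda>x. indicator B x *\<^sub>R cis (u \<bullet> x))"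
    unfolding B_def by (intro borel_integrable_compact compact_cbox continuous_intros)
  then have "integrable lborel (\<lambda>x. indicator B x *\<^sub>R cis (u \<bullet> x) * cis s)"
    by (rule integrable_mult_left)
  then have "(\<integral>x. Re (indicator B x *\<^sub>R cis (u \<bullet> x) * cis s) \<partial>lborel)
      = Re (\<integral>x. indicator B x *\<^sub>R cis (u \<bullet> x) * cis s \<partial>lborel)"
    by (rule integral_Re)
  also have "\<dots> = (if u = 0 then (2 * pi) ^ (2 * CARD('q)) * cos s else 0)"
    unfolding integral_mult_left_zero cis_int by (simp del: of_real_power of_real_mult)
  finally show ?thesis
    by (simp add: torus_integral_def set_lebesgue_integral_def B_def zero_prod_def cos_add right_diff_distrib)
qed

lemma torus_integral_harmonic:
  fixes n m :: "int ^ 'q::finite"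
  shows "torus_integral (\<lambda>p. cos (phase n m p + s))
       = (if freq n m = 0 then (2 * pi) ^ (2 * CARD('q)) * cos s else 0)"
  unfolding phase_eq_inner by (rule torus_integral_cos_inner) (rule freq_inner_Basis_int)

section \<open>Linearity and normalization of the torus integral\<close>

lemma torus_integrable:
  assumes "continuous_on UNIV (f :: 'q::finite pt \<Rightarrow> real)"
  shows "set_integrable lborel (cbox (0, 0) (\<chi> i. 2 * pi, \<chi> i. 2 * pi)) f"
  unfolding set_integrable_def
  by (intro borel_integrable_compact compact_cbox continuous_on_subset[OF assms]) auto

lemma torus_integral_add:
  assumes "continuous_on UNIV f" "continuous_on UNIV g"
  shows "torus_integral (\<lambda>p. f p + g p) = torus_integral f + torus_integral g"
  unfolding torus_integral_def by (rule set_integral_add(2)) (intro torus_integrable assms)+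

lemma torus_integral_cmult: "torus_integral (\<lambda>p. c * f p) = c * torus_integral f"
  by (simp add: torus_integral_def)

lemma torus_integral_const: "torus_integral (\<lambda>p::'q::finite pt. c) = c * (2 * pi) ^ (2 * CARD('q))"
  using torus_integral_harmonic[of "0::int^'q" 0 0] torus_integral_cmult[of c "\<lambda>p::'q pt. 1"]
  by (simp add: freq_simps phase_def)

section \<open>Hamiltonian vector fields\<close>

text \<open>The complex structure that turns a gradient into the Hamiltonian vector field, with the
  sign fixed by the convention that \<open>\<omega>\<close> takes the field in its second
  slot.\<close>

definition rot :: "'q::finite pt \<Rightarrow> 'q pt" where
  "rot g = (- snd g, fst g)"

lemma sympl_form_rot: "sympl_form v (rot g) = v \<bullet> g"
  by (cases v, cases g) (simp add: sympl_form_def rot_def inner_vec_def sum.distrib)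

lemma ex_rot: "\<exists>g. w = rot g"
  by (rule exI[of _ "(snd w, - fst w)"]) (simp add: rot_def)

lemma rot_scaleR: "rot (c *\<^sub>R g) = c *\<^sub>R rot g"
  and rot_add: "rot (g + h) = rot g + rot h"
  and rot_diff: "rot (g - h) = rot g - rot h"
  by (simp_all add: rot_def scaleR_prod_def plus_prod_def)

lemma sympl_form_swap: "sympl_form u v = - sympl_form v u"
  by (simp add: sympl_form_def sum_negf[symmetric] algebra_simps)

lemma bilinear_sympl_form: "bilinear sympl_form"
  unfolding bilinear_def
  by (auto intro!: linearI simp: sympl_form_def sum.distrib[symmetric] sum_distrib_left algebra_simps)

lemmas sympl_form_simps =
  bilinear_ladd[OF bilinear_sympl_form] bilinear_radd[OF bilinear_sympl_form]
  bilinear_lmul[OF bilinear_sympl_form] bilinear_rmul[OF bilinear_sympl_form]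
  bilinear_lneg[OF bilinear_sympl_form] bilinear_rneg[OF bilinear_sympl_form]

lemma sympl_form_nondegenerate:
  assumes "\<And>v. sympl_form v w = sympl_form v w'"
  shows "w = w'"
proof -
  obtain g g' where "w = rot g" "w' = rot g'"
    using ex_rot by metis
  with assms have "\<And>v. v \<bullet> g = v \<bullet> g'"
    by (simp add: sympl_form_rot)
  then have "g = g'"
    by (rule vector_eq_ldot[THEN iffD1, OF allI])
  with \<open>w = rot g\<close> \<open>w' = rot g'\<close> show ?thesis by simp
qed

text \<open>Resolves the description in \<open>ham_vf\<close>: the rotated gradient is a solution,
  and nondegeneracy of the symplectic form makes it the only one.\<close>

lemma sympl_form_ham_vf:
  assumes "f differentiable at p"
  shows "sympl_form v (ham_vf f p) = frechet_derivative f (at p) v"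
proof -
  define f' where "f' = frechet_derivative f (at p)"
  have lin: "linear f'"
    unfolding f'_def by (rule linear_frechet_derivative[OF assms])
  \<comment> \<open>This is the gradient, assembled from the partial derivatives.\<close>
  define g where "g = (\<Sum>b\<in>Basis. f' b *\<^sub>R b)"
  have "f' v = v \<bullet> g" for v
  proof -
    have "f' v = f' (\<Sum>b\<in>Basis. (v \<bullet> b) *\<^sub>R b)"
      by (simp add: euclidean_representation)
    also have "\<dots> = v \<bullet> g"
      by (simp add: linear_sum[OF lin] linear_scale[OF lin] g_def inner_sum_right mult.commute)
    finally show ?thesis .
  qed
  then have g: "\<forall>v. sympl_form v (rot g) = f' v"
    by (simp add: sympl_form_rot)
  moreover have "w = rot g" if "\<forall>v. sympl_form v w = f' v" for w
    using that g by (intro sympl_form_nondegenerate) metis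
  ultimately have "\<forall>v. sympl_form v (ham_vf f p) = f' v"
    unfolding ham_vf_def f'_def[symmetric] by (rule theI[of _ "rot g"])
  then show ?thesis
    unfolding f'_def by (rule spec)
qed

lemma ham_vf_eqI:
  assumes "(f has_derivative f') (at p)" "\<And>v. sympl_form v w = f' v"
  shows "ham_vf f p = w"
proof -
  have "f differentiable at p" "f' = frechet_derivative f (at p)"
    using assms(1) frechet_derivative_at by (auto simp: differentiable_def)
  then show ?thesis
    using assms(2) by (intro sympl_form_nondegenerate) (simp add: sympl_form_ham_vf)
qed

lemma has_derivative_sympl_form:
  assumes "f differentiable at p"
  shows "(f has_derivative (\<lambda>v. sympl_form v (ham_vf f p))) (at p)"
  using assms by (simp add: sympl_form_ham_vf frechet_derivative_works flip: eta_contract_eq)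

lemma ham_vf_add:
  assumes "f differentiable at p" "g differentiable at p"
  shows "ham_vf (\<lambda>p. f p + g p) p = ham_vf f p + ham_vf g p"
  by (rule ham_vf_eqI[OF has_derivative_add[OF assms[THEN has_derivative_sympl_form]]])
     (simp add: sympl_form_simps)

lemma ham_vf_cmult:
  assumes "f differentiable at p"
  shows "ham_vf (\<lambda>p. c * f p) p = c *\<^sub>R ham_vf f p"
  by (rule ham_vf_eqI[OF has_derivative_mult_right[OF has_derivative_sympl_form[OF assms]]])
     (simp add: sympl_form_simps)

lemma ham_vf_mult:
  assumes "f differentiable at p" "g differentiable at p"
  shows "ham_vf (\<lambda>p. f p * g p) p = f p *\<^sub>R ham_vf g p + g p *\<^sub>R ham_vf f p"
  by (rule ham_vf_eqI[OF has_derivative_mult[OF assms[THEN has_derivative_sympl_form]]])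
     (simp add: sympl_form_simps)

lemma smooth_imp_differentiable: "smooth f \<Longrightarrow> f differentiable at p"
  unfolding smooth_def by (metis C_diff.simps(2))

text \<open>Two Hamiltonians of the same field differ by a function with zero derivative, hence by a
  constant, and the normalization of the mean forces that constant to be 0.\<close>

lemma hamiltonian_of_ham_vf:
  assumes "normalized_hamiltonian (f :: 'q::finite pt \<Rightarrow> real)"
  shows "hamiltonian_of (ham_vf f) = f"
  unfolding hamiltonian_of_def
proof (rule the_equality)
  show "normalized_hamiltonian f \<and> ham_vf f = ham_vf f" using assms by simp
next
  fix g assume g: "normalized_hamiltonian g \<and> ham_vf g = ham_vf f"
  have diff: "f differentiable at p" "g differentiable at p" for p
    using assms g smooth_imp_differentiable by (auto simp: normalized_hamiltonian_def)
  have "((\<lambda>p. g p - f p) has_derivative (\<lambda>v. 0)) (at p)" for p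
    using has_derivative_diff[OF diff(2,1)[THEN has_derivative_sympl_form], of p] g by simp
  then obtain c where c: "\<And>p. g p - f p = c"
    using has_derivative_zero_constant[of UNIV "\<lambda>p. g p - f p"] by auto
  have "continuous_on UNIV f"
    using diff(1) by (simp add: continuous_on_eq_continuous_at differentiable_imp_continuous_within)
  then have "torus_integral (\<lambda>p. f p + c) = torus_integral f + c * (2 * pi) ^ (2 * CARD('q))"
    by (simp add: torus_integral_add torus_integral_const)
  moreover have "g = (\<lambda>p. f p + c)"
    using c by (auto simp: fun_eq_iff algebra_simps)
  ultimately have "c = 0"
    using assms g by (simp add: normalized_hamiltonian_def)
  then show "g = f" using c by auto
qed

section \<open>Poisson brackets and bilinearity of the Lie bracket\<close>

definition poisson :: "('q::finite pt \<Rightarrow> real) \<Rightarrow> ('q pt \<Rightarrow> real) \<Rightarrow> 'q pt \<Rightarrow> real" where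
  "poisson f g p = sympl_form (ham_vf f p) (ham_vf g p)"

lemma poisson_swap: "poisson f g p = - poisson g f p"
  unfolding poisson_def by (rule sympl_form_swap)

lemma lie_bracket_swap: "lie_bracket X Y p = - lie_bracket Y X p"
  by (simp add: lie_bracket_def)

lemma frechet_derivative_add:
  assumes "f differentiable at p" "g differentiable at p"
  shows "frechet_derivative (\<lambda>p. f p + g p) (at p) v
       = frechet_derivative f (at p) v + frechet_derivative g (at p) v"
  using has_derivative_add[OF assms[unfolded frechet_derivative_works]]
  by (simp flip: frechet_derivative_at)

lemma frechet_derivative_scaleR_const:
  assumes "f differentiable at p"
  shows "frechet_derivative (\<lambda>p. c *\<^sub>R f p) (at p) v = c *\<^sub>R frechet_derivative f (at p) v"
  using has_derivative_scaleR_right[OF assms[unfolded frechet_derivative_works], of c]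
  by (simp flip: frechet_derivative_at)

lemma lie_bracket_add_left:
  assumes "\<And>p. X differentiable at p" "\<And>p. X' differentiable at p" "\<And>p. Y differentiable at p"
  shows "lie_bracket (\<lambda>p. X p + X' p) Y p = lie_bracket X Y p + lie_bracket X' Y p"
  using assms
  by (simp add: lie_bracket_def frechet_derivative_add linear_add[OF linear_frechet_derivative])

lemma lie_bracket_scaleR_left:
  assumes "\<And>p. X differentiable at p" "\<And>p. Y differentiable at p"
  shows "lie_bracket (\<lambda>p. c *\<^sub>R X p) Y p = c *\<^sub>R lie_bracket X Y p"
  using assms
  by (simp add: lie_bracket_def frechet_derivative_scaleR_const linear_scale[OF linear_frechet_derivative] scaleR_diff_right)

lemma lie_bracket_add_right:
  assumes "\<And>p. X differentiable at p" "\<And>p. Y differentiable at p" "\<And>p. Y' differentiable at p"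
  shows "lie_bracket X (\<lambda>p. Y p + Y' p) p = lie_bracket X Y p + lie_bracket X Y' p"
  unfolding lie_bracket_swap[of X] lie_bracket_add_left[of Y Y' X, OF assms(2,3,1)] by simp

lemma lie_bracket_scaleR_right:
  assumes "\<And>p. X differentiable at p" "\<And>p. Y differentiable at p"
  shows "lie_bracket X (\<lambda>p. c *\<^sub>R Y p) p = c *\<^sub>R lie_bracket X Y p"
  unfolding lie_bracket_swap[of X] lie_bracket_scaleR_left[of Y X, OF assms(2,1)] by simp

section \<open>Trigonometric polynomials\<close>

text \<open>The arbitrary shift \<open>s\<close> makes sines and cosines a single kind of generator,
  and frequency 0 supplies the constants; every induction thus has one base case.\<close>

inductive trig_poly :: "('q::finite pt \<Rightarrow> real) \<Rightarrow> bool" where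
  harmonic: "trig_poly (\<lambda>p. cos (phase n m p + s))"
| cmult: "trig_poly f \<Longrightarrow> trig_poly (\<lambda>p. c * f p)"
| add: "trig_poly f \<Longrightarrow> trig_poly g \<Longrightarrow> trig_poly (\<lambda>p. f p + g p)"

lemma trig_poly_diff:
  assumes "trig_poly f" "trig_poly g"
  shows "trig_poly (\<lambda>p. f p - g p)"
  using trig_poly.add[OF assms(1) trig_poly.cmult[OF assms(2), of "-1"]] by simp

lemma trig_poly_sin: "trig_poly (\<lambda>p. sin (phase n m p + s))"
proof -
  have "sin (phase n m p + s) = cos (phase n m p + (s - pi / 2))" for p
    using cos_diff[of "phase n m p + s" "pi / 2"] by (simp add: add_diff_eq)
  then show ?thesis
    using trig_poly.harmonic[of n m "s - pi / 2"] by (simp only:)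
qed

lemma phase_simps:
  "phase (n + k) (m + l) p = phase n m p + phase k l p"
  "phase (n - k) (m - l) p = phase n m p - phase k l p"
  by (simp_all add: phase_eq_inner freq_simps inner_add_left inner_diff_left)

lemma phase_shift_simps:
  "phase (n + k) (m + l) p + (s + t) = (phase n m p + s) + (phase k l p + t)"
  "phase (n - k) (m - l) p + (s - t) = (phase n m p + s) - (phase k l p + t)"
  by (simp_all add: phase_simps)

text \<open>Product-to-sum: only the difference and the sum of the two frequencies occur.\<close>

lemma trig_poly_harmonic_mult: "trig_poly (\<lambda>p. cos (phase n m p + s) * cos (phase k l p + t))"
proof -
  have "(\<lambda>p. cos (phase n m p + s) * cos (phase k l p + t))
      = (\<lambda>p. 1 / 2 * cos (phase (n - k) (m - l) p + (s - t)) + 1 / 2 * cos (phase (n + k) (m + l) p + (s + t)))"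
    by (rule ext) (simp add: phase_shift_simps cos_times_cos add_divide_distrib)
  then show ?thesis
    using trig_poly.add[OF trig_poly.cmult trig_poly.cmult, OF trig_poly.harmonic trig_poly.harmonic]
    by (simp only:)
qed

lemma trig_poly_mult:
  assumes "trig_poly f" "trig_poly g"
  shows "trig_poly (\<lambda>p. f p * g p)"
  using assms(1)
proof induction
  case (harmonic n m s)
  show ?case
    using assms(2)
  proof induction
    case (harmonic k l t)
    show ?case by (rule trig_poly_harmonic_mult)
  next
    case (cmult g c)
    from trig_poly.cmult[OF cmult.IH, of c] show ?case by (simp add: mult.left_commute)
  next
    case (add g h)
    from trig_poly.add[OF add.IH] show ?case by (simp add: algebra_simps)
  qed
next
  case (cmult f c)
  from trig_poly.cmult[OF cmult.IH, of c] show ?case by (simp add: mult.assoc)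
next
  case (add f h)
  from trig_poly.add[OF add.IH] show ?case by (simp add: algebra_simps)
qed

lemma has_derivative_harmonic:
  "((\<lambda>p. cos (phase n m p + s)) has_derivative (\<lambda>v. - sin (phase n m p + s) * (freq n m \<bullet> v))) (at p)"
  unfolding phase_eq_inner by (auto intro!: derivative_eq_intros simp: fun_eq_iff)

lemma trig_poly_differentiable: "trig_poly f \<Longrightarrow> f differentiable at p"
proof (induction rule: trig_poly.induct)
  case (harmonic n m s)
  show ?case unfolding differentiable_def by (rule exI) (rule has_derivative_harmonic)
qed auto

lemma trig_poly_continuous: "trig_poly f \<Longrightarrow> continuous_on UNIV f"
  by (simp add: continuous_on_eq_continuous_at differentiable_imp_continuous_within trig_poly_differentiable)

lemma trig_poly_frechet_derivative: "trig_poly f \<Longrightarrow> trig_poly (\<lambda>p. frechet_derivative f (at p) v)"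
proof (induction rule: trig_poly.induct)
  case (harmonic n m s)
  show ?case
    using trig_poly.cmult[OF trig_poly_sin, of "- (freq n m \<bullet> v)" n m s]
    by (simp add: mult.commute flip: frechet_derivative_at[OF has_derivative_harmonic])
next
  case (cmult f c)
  from trig_poly.cmult[OF cmult.IH, of c] cmult.hyps show ?case
    using frechet_derivative_scaleR_const[of f _ c v] by (simp add: trig_poly_differentiable)
next
  case (add f g)
  from trig_poly.add[OF add.IH] add.hyps show ?case
    by (simp add: frechet_derivative_add trig_poly_differentiable)
qed

text \<open>Directional derivatives stay in the class, so the induction on the order runs over all
  trigonometric polynomials at once.\<close>

lemma trig_poly_C_diff: "trig_poly f \<Longrightarrow> C_diff k f"
  by (induction k arbitrary: f)
     (auto simp: trig_poly_continuous trig_poly_differentiable trig_poly_frechet_derivative)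

lemma trig_poly_smooth: "trig_poly f \<Longrightarrow> smooth f"
  by (simp add: smooth_def trig_poly_C_diff)

lemma trig_poly_periodic: "trig_poly f \<Longrightarrow> torus_periodic f"
proof (induction rule: trig_poly.induct)
  case (harmonic n m s)
  \<comment> \<open>A lattice translation changes the phase by an integer multiple of
    \<open>2 * pi\<close>, because the frequencies are integral.\<close>
  have "phase n m (x + (\<chi> i. 2 * pi * of_int (a $ i)), y + (\<chi> i. 2 * pi * of_int (b $ i)))
      = phase n m (x, y) + of_int (zdot n a + zdot m b) * (2 * pi)" for a b x y
    by (simp add: phase_def zdot_def sum.distrib sum_distrib_left sum_distrib_right algebra_simps)
  moreover have "cos (t + of_int j * (2 * pi) + s) = cos (t + s)" for t and j :: int
    using cos.plus_of_int[of "t + s" j] by (simp add: ac_simps)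
  ultimately show ?case
    unfolding torus_periodic_def by (simp only: simp_thms)
qed (auto simp: torus_periodic_def)

lemma trig_poly_normalized:
  "trig_poly f \<Longrightarrow> torus_integral f = 0 \<Longrightarrow> normalized_hamiltonian f"
  by (simp add: normalized_hamiltonian_def trig_poly_smooth trig_poly_periodic)

lemma ham_vf_harmonic:
  "ham_vf (\<lambda>p. cos (phase n m p + s)) = (\<lambda>p. - sin (phase n m p + s) *\<^sub>R rot (freq n m))"
  by (rule ext, rule ham_vf_eqI[OF has_derivative_harmonic])
     (simp add: sympl_form_simps sympl_form_rot inner_commute)

lemma trig_poly_ham_vf_cmult:
  "trig_poly f \<Longrightarrow> ham_vf (\<lambda>p. c * f p) = (\<lambda>p. c *\<^sub>R ham_vf f p)"
  by (rule ext) (simp add: ham_vf_cmult trig_poly_differentiable)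

lemma trig_poly_ham_vf_add:
  "trig_poly f \<Longrightarrow> trig_poly g \<Longrightarrow> ham_vf (\<lambda>p. f p + g p) = (\<lambda>p. ham_vf f p + ham_vf g p)"
  by (rule ext) (simp add: ham_vf_add trig_poly_differentiable)

lemma has_derivative_ham_vf_harmonic:
  "(ham_vf (\<lambda>p. cos (phase n m p + s)) has_derivative
     (\<lambda>v. - (cos (phase n m p + s) * (freq n m \<bullet> v)) *\<^sub>R rot (freq n m))) (at p)"
  unfolding phase_eq_inner ham_vf_harmonic[unfolded phase_eq_inner]
  by (auto intro!: derivative_eq_intros simp: fun_eq_iff)

lemma trig_poly_ham_vf_differentiable: "trig_poly f \<Longrightarrow> ham_vf f differentiable at p"
proof (induction rule: trig_poly.induct)
  case (harmonic n m s)
  show ?case unfolding differentiable_def by (rule exI) (rule has_derivative_ham_vf_harmonic)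
qed (auto simp: trig_poly_ham_vf_cmult trig_poly_ham_vf_add)

section \<open>Poisson brackets of trigonometric polynomials\<close>

lemma poisson_cmult_left:
  "trig_poly f \<Longrightarrow> poisson (\<lambda>p. c * f p) g = (\<lambda>p. c * poisson f g p)"
  by (simp add: poisson_def[abs_def] trig_poly_ham_vf_cmult sympl_form_simps)

lemma poisson_cmult_right:
  "trig_poly g \<Longrightarrow> poisson f (\<lambda>p. c * g p) = (\<lambda>p. c * poisson f g p)"
  by (simp add: poisson_def[abs_def] trig_poly_ham_vf_cmult sympl_form_simps)

lemma poisson_add_left:
  "trig_poly f \<Longrightarrow> trig_poly h \<Longrightarrow> poisson (\<lambda>p. f p + h p) g = (\<lambda>p. poisson f g p + poisson h g p)"
  by (simp add: poisson_def[abs_def] trig_poly_ham_vf_add sympl_form_simps)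

lemma poisson_add_right:
  "trig_poly g \<Longrightarrow> trig_poly h \<Longrightarrow> poisson f (\<lambda>p. g p + h p) = (\<lambda>p. poisson f g p + poisson f h p)"
  by (simp add: poisson_def[abs_def] trig_poly_ham_vf_add sympl_form_simps)

lemma poisson_mult_right:
  assumes "trig_poly g" "trig_poly h"
  shows "poisson f (\<lambda>p. g p * h p) p = g p * poisson f h p + h p * poisson f g p"
  using assms by (simp add: poisson_def ham_vf_mult trig_poly_differentiable sympl_form_simps)

text \<open>Each field is a sine times a constant direction \<open>rot (freq _ _)\<close>, so the
  bracket is the symplectic pairing of the frequencies times two sines.\<close>

lemma poisson_harmonic:
  "poisson (\<lambda>p. cos (phase n m p + s)) (\<lambda>p. cos (phase k l p + t)) p
   = (rot (freq n m) \<bullet> freq k l) * (sin (phase n m p + s) * sin (phase k l p + t))"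
  by (simp add: poisson_def ham_vf_harmonic sympl_form_simps sympl_form_rot)

lemma poisson_harmonic':
  "poisson (\<lambda>p. cos (phase n m p + s)) (\<lambda>p. cos (phase k l p + t))
   = (\<lambda>p. (rot (freq n m) \<bullet> freq k l) / 2 *
       (cos (phase (n - k) (m - l) p + (s - t)) - cos (phase (n + k) (m + l) p + (s + t))))"
  by (rule ext) (simp add: poisson_harmonic phase_shift_simps sin_times_sin)

lemma rot_inner: "rot (freq n m) \<bullet> freq k l = of_int (zdot n l - zdot m k)"
  by (simp add: rot_def freq_def zdot_def inner_vec_def sum_negf)

lemma rot_inner_self: "rot g \<bullet> g = 0"
  by (cases g) (simp add: rot_def inner_commute)

text \<open>Reduces bilinear statements to pairs of harmonics: the outer induction is on
  \<open>f\<close>, and an induction on \<open>g\<close> settles its base case.\<close>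

lemma trig_poly_bilinear_induct
    [consumes 2, case_names harmonic cmult_left cmult_right add_left add_right]:
  assumes f: "trig_poly f" and g: "trig_poly g"
    and base: "\<And>n m s k l t. P (\<lambda>p. cos (phase n m p + s)) (\<lambda>p. cos (phase k l p + t))"
    and "\<And>f g c. trig_poly f \<Longrightarrow> trig_poly g \<Longrightarrow> P f g \<Longrightarrow> P (\<lambda>p. c * f p) g"
    and "\<And>f g c. trig_poly f \<Longrightarrow> trig_poly g \<Longrightarrow> P f g \<Longrightarrow> P f (\<lambda>p. c * g p)"
    and "\<And>f g h. trig_poly f \<Longrightarrow> trig_poly g \<Longrightarrow> trig_poly h \<Longrightarrow> P f g \<Longrightarrow> P h g \<Longrightarrow> P (\<lambda>p. f p + h p) g"
    and "\<And>f g h. trig_poly f \<Longrightarrow> trig_poly g \<Longrightarrow> trig_poly h \<Longrightarrow> P f g \<Longrightarrow> P f h \<Longrightarrow> P f (\<lambda>p. g p + h p)"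
  shows "P f g"
  using f
proof induction
  case (harmonic n m s)
  show ?case
    using g by induction (auto intro: assms trig_poly.harmonic)
qed (auto intro: assms)

lemma trig_poly_poisson:
  assumes "trig_poly f" "trig_poly g"
  shows "trig_poly (poisson f g)"
  using assms
proof (induction rule: trig_poly_bilinear_induct)
  case (harmonic n m s k l t)
  show ?case
    unfolding poisson_harmonic' by (intro trig_poly.cmult trig_poly_diff trig_poly.harmonic)
qed (simp_all add: poisson_cmult_left poisson_cmult_right poisson_add_left poisson_add_right trig_poly.intros)

text \<open>Only terms of frequency 0 have a nonzero mean. Such a term would need frequencies equal
  up to sign, and there the coefficient of the bracket vanishes.\<close>

lemma torus_integral_poisson:
  assumes "trig_poly f" "trig_poly g"
  shows "torus_integral (poisson f g) = 0"
  using assms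
proof (induction rule: trig_poly_bilinear_induct)
  case (harmonic n m s k l t)
  let ?c = "rot (freq n m) \<bullet> freq k l"
  have "freq n m \<noteq> freq k l" "freq n m \<noteq> - freq k l" if "?c \<noteq> 0"
    using that rot_inner_self[of "freq k l"] rot_scaleR[of "-1" "freq k l"] by auto
  then have *: "freq (n - k) (m - l) \<noteq> 0" "freq (n + k) (m + l) \<noteq> 0" if "?c \<noteq> 0"
    using that by (auto simp: freq_simps(1,2) eq_neg_iff_add_eq_0)
  show ?case
  proof (cases "?c = 0")
    case True
    then show ?thesis
      by (simp add: poisson_harmonic' torus_integral_const)
  next
    case False
    let ?d = "\<lambda>p. cos (phase (n - k) (m - l) p + (s - t))"
    let ?e = "\<lambda>p. cos (phase (n + k) (m + l) p + (s + t))"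
    have "torus_integral (\<lambda>p. ?d p + - 1 * ?e p) = torus_integral ?d + torus_integral (\<lambda>p. - 1 * ?e p)"
      by (intro torus_integral_add trig_poly_continuous[OF trig_poly.harmonic]
           trig_poly_continuous[OF trig_poly.cmult[OF trig_poly.harmonic]])
    moreover have "torus_integral ?d = 0" "torus_integral (\<lambda>p. - 1 * ?e p) = 0"
      unfolding torus_integral_cmult torus_integral_harmonic using *[OF False] by simp_all
    ultimately have "torus_integral (\<lambda>p. ?c / 2 * (?d p + - 1 * ?e p)) = 0"
      unfolding torus_integral_cmult by (simp only: mult_zero_right add_0_right)
    then show ?thesis
      by (simp add: poisson_harmonic')
  qed
qed (simp_all add: poisson_cmult_left poisson_cmult_right poisson_add_left poisson_add_right
      torus_integral_cmult torus_integral_add trig_poly_continuous trig_poly_poisson)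

text \<open>Infinitesimal Ad-invariance of the metric: \<open>poisson f\<close> is a derivation
  whose values have mean 0, so it is skew for the \<open>L\<^sup>2\<close> product.\<close>

lemma torus_integral_poisson_by_parts:
  assumes "trig_poly f" "trig_poly g" "trig_poly h"
  shows "torus_integral (\<lambda>p. poisson f g p * h p) = - torus_integral (\<lambda>p. g p * poisson f h p)"
proof -
  have "0 = torus_integral (poisson f (\<lambda>p. g p * h p))"
    using assms by (simp add: torus_integral_poisson trig_poly_mult)
  also have "poisson f (\<lambda>p. g p * h p) = (\<lambda>p. poisson f g p * h p + g p * poisson f h p)"
    using assms by (auto simp: poisson_mult_right)
  also have "torus_integral \<dots> = torus_integral (\<lambda>p. poisson f g p * h p) + torus_integral (\<lambda>p. g p * poisson f h p)"
    using assms by (intro torus_integral_add trig_poly_continuous trig_poly_mult trig_poly_poisson)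
  finally show ?thesis by simp
qed

text \<open>Matches the field of the bracket of two harmonics with their commutator;
  \<open>U\<close> and \<open>V\<close> stand for the rotated frequencies. Pairing with an arbitrary
  vector leaves the addition formulas for the sine.\<close>

lemma sin_combination:
  fixes U V :: "'a::real_inner"
  shows "(c / 2) *\<^sub>R (- sin (a - b) *\<^sub>R (U - V) + - 1 *\<^sub>R - sin (a + b) *\<^sub>R (U + V))
       = c *\<^sub>R ((cos a * sin b) *\<^sub>R U + (sin a * cos b) *\<^sub>R V)"
  by (rule vector_eq_ldot[THEN iffD1, OF allI]) (simp add: inner_simps sin_add sin_diff field_simps)

text \<open>For two harmonics both sides are explicit combinations of the constant fields
  \<open>rot (freq n m)\<close> and \<open>rot (freq k l)\<close>; bilinearity gives the
  rest.\<close>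

lemma lie_bracket_ham_vf:
  assumes "trig_poly f" "trig_poly g"
  shows "lie_bracket (ham_vf f) (ham_vf g) = ham_vf (poisson f g)"
  using assms
proof (induction rule: trig_poly_bilinear_induct)
  case (harmonic n m s k l t)
  let ?c = "rot (freq n m) \<bullet> freq k l"
  \<comment> \<open>The two directional derivatives in the commutator produce these pairings, which
    are opposite by skew-symmetry.\<close>
  have c: "freq k l \<bullet> rot (freq n m) = ?c" "freq n m \<bullet> rot (freq k l) = - ?c"
    by (simp_all add: inner_commute[of "freq _ _" "rot _"] rot_inner) (simp add: zdot_def mult.commute)
  show ?case
  proof
    fix p :: "'a pt"
    let ?d = "\<lambda>p. cos (phase (n - k) (m - l) p + (s - t))"
    let ?e = "\<lambda>p. cos (phase (n + k) (m + l) p + (s + t))"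
    have "poisson (\<lambda>p. cos (phase n m p + s)) (\<lambda>p. cos (phase k l p + t))
       = (\<lambda>p. ?c / 2 * (?d p + - 1 * ?e p))"
      by (simp add: poisson_harmonic')
    then have "ham_vf (poisson (\<lambda>p. cos (phase n m p + s)) (\<lambda>p. cos (phase k l p + t))) p
       = (?c / 2) *\<^sub>R (ham_vf ?d p + - 1 *\<^sub>R ham_vf ?e p)"
      by (simp only: trig_poly_ham_vf_add[OF trig_poly.harmonic trig_poly.cmult[OF trig_poly.harmonic]]
          trig_poly_ham_vf_cmult[OF trig_poly.harmonic]
          trig_poly_ham_vf_cmult[OF trig_poly.add[OF trig_poly.harmonic trig_poly.cmult[OF trig_poly.harmonic]]])
    also have "\<dots> = ?c *\<^sub>R ((cos (phase n m p + s) * sin (phase k l p + t)) *\<^sub>R rot (freq n m)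
                    + (sin (phase n m p + s) * cos (phase k l p + t)) *\<^sub>R rot (freq k l))"
      unfolding ham_vf_harmonic freq_simps rot_diff rot_add
      unfolding phase_shift_simps by (rule sin_combination)
    also have "\<dots> = lie_bracket (ham_vf (\<lambda>p. cos (phase n m p + s))) (ham_vf (\<lambda>p. cos (phase k l p + t))) p"
      unfolding lie_bracket_def frechet_derivative_at[OF has_derivative_ham_vf_harmonic, symmetric]
      unfolding ham_vf_harmonic by (simp add: c algebra_simps)
    finally show "lie_bracket (ham_vf (\<lambda>p. cos (phase n m p + s))) (ham_vf (\<lambda>p. cos (phase k l p + t))) p
       = ham_vf (poisson (\<lambda>p. cos (phase n m p + s)) (\<lambda>p. cos (phase k l p + t))) p" ..
  qed
next
  case (cmult_left f g c)
  then show ?case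
    by (intro ext) (simp add: poisson_cmult_left trig_poly_ham_vf_cmult trig_poly_poisson
        lie_bracket_scaleR_left trig_poly_ham_vf_differentiable)
next
  case (cmult_right f g c)
  then show ?case
    by (intro ext) (simp add: poisson_cmult_right trig_poly_ham_vf_cmult trig_poly_poisson
        lie_bracket_scaleR_right trig_poly_ham_vf_differentiable)
next
  case (add_left f g h)
  then show ?case
    by (intro ext) (simp add: poisson_add_left trig_poly_ham_vf_add trig_poly_poisson
        lie_bracket_add_left trig_poly_ham_vf_differentiable)
next
  case (add_right f g h)
  then show ?case
    by (intro ext) (simp add: poisson_add_right trig_poly_ham_vf_add trig_poly_poisson
        lie_bracket_add_right trig_poly_ham_vf_differentiable)
qed

section \<open>Curvature\<close>

lemma nabla0_ham_vf:
  assumes "trig_poly f" "trig_poly g"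
  shows "nabla0 (ham_vf f) (ham_vf g) = ham_vf (\<lambda>p. 1 / 2 * poisson f g p)"
  unfolding nabla0_def lie_bracket_ham_vf[OF assms]
  by (simp only: trig_poly_ham_vf_cmult[OF trig_poly_poisson[OF assms]])

lemma poisson_self: "poisson g g = (\<lambda>p. 0)"
  using poisson_swap[of g g] by (auto simp: fun_eq_iff)

text \<open>With \<open>G = poisson f g\<close>, the term with \<open>nabla0 Y Y\<close> vanishes,
  the second term contributes -1/4 and the last one +1/2 of the field of
  \<open>poisson g G\<close>.\<close>

lemma curvature0_ham_vf:
  assumes f: "trig_poly f" and g: "trig_poly g"
  shows "curvature0 (ham_vf f) (ham_vf g) (ham_vf g) = ham_vf (\<lambda>p. 1 / 4 * poisson g (poisson f g) p)"
proof (rule ext)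
  fix p
  define G where "G = poisson f g"
  have G: "trig_poly G" unfolding G_def using f g by (rule trig_poly_poisson)
  note gG = trig_poly_poisson[OF g G] and Gg = trig_poly_poisson[OF G g]
  have zero: "ham_vf (\<lambda>p. 1 / 2 * poisson g g p) = (\<lambda>p. 0)"
    unfolding trig_poly_ham_vf_cmult[OF trig_poly_poisson[OF g g]]
    by (simp add: lie_bracket_def fun_eq_iff flip: lie_bracket_ham_vf[OF g g])
  have "nabla0 (ham_vf f) (nabla0 (ham_vf g) (ham_vf g)) p = 0"
    unfolding nabla0_ham_vf[OF g g] zero
    using linear_0[OF linear_frechet_derivative[OF trig_poly_ham_vf_differentiable[OF f]]]
    by (simp add: nabla0_def lie_bracket_def)
  moreover have "nabla0 (ham_vf g) (nabla0 (ham_vf f) (ham_vf g)) p = (1 / 4) *\<^sub>R ham_vf (poisson g G) p"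
    unfolding nabla0_ham_vf[OF f g] G_def[symmetric] nabla0_ham_vf[OF g trig_poly.cmult[OF G]]
      poisson_cmult_right[OF G] trig_poly_ham_vf_cmult[OF trig_poly.cmult[OF gG]] trig_poly_ham_vf_cmult[OF gG]
    by simp
  moreover have "poisson G g = (\<lambda>p. - 1 * poisson g G p)"
    by (rule ext) (simp add: poisson_swap[of G])
  then have "nabla0 (lie_bracket (ham_vf f) (ham_vf g)) (ham_vf g) p = - (1 / 2) *\<^sub>R ham_vf (poisson g G) p"
    unfolding lie_bracket_ham_vf[OF f g] G_def[symmetric] nabla0_ham_vf[OF G g] trig_poly_ham_vf_cmult[OF Gg]
    by (simp only: trig_poly_ham_vf_cmult[OF gG]) simp
  ultimately have "curvature0 (ham_vf f) (ham_vf g) (ham_vf g) p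
      = 0 - (1 / 4) *\<^sub>R ham_vf (poisson g G) p - - (1 / 2) *\<^sub>R ham_vf (poisson g G) p"
    by (simp only: curvature0_def)
  also have "\<dots> = (1 / 4) *\<^sub>R ham_vf (poisson g G) p"
    by (rule vector_eq_ldot[THEN iffD1, OF allI]) (simp add: inner_simps)
  finally show "curvature0 (ham_vf f) (ham_vf g) (ham_vf g) p = ham_vf (\<lambda>p. 1 / 4 * poisson g (poisson f g) p) p"
    by (simp only: trig_poly_ham_vf_cmult[OF gG] G_def[symmetric])
qed

lemma inner_e_ham_vf:
  assumes "trig_poly f" "torus_integral f = 0" "trig_poly g" "torus_integral g = 0"
  shows "inner_e (ham_vf f) (ham_vf g) = torus_integral (\<lambda>p. f p * g p)"
  using assms by (simp add: inner_e_def hamiltonian_of_ham_vf trig_poly_normalized)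

text \<open>Skew-symmetry of \<open>poisson g\<close> moves one bracket onto \<open>f\<close>, which
  leaves the square of \<open>poisson f g\<close>.\<close>

lemma inner_e_curvature0:
  assumes f: "trig_poly f" "torus_integral f = 0" and g: "trig_poly g"
  shows "inner_e (curvature0 (ham_vf f) (ham_vf g) (ham_vf g)) (ham_vf f)
       = 1 / 4 * torus_integral (\<lambda>p. (poisson f g p)\<^sup>2)"
proof -
  let ?G = "poisson f g"
  have G: "trig_poly ?G" "trig_poly (poisson g ?G)" using f g by (simp_all add: trig_poly_poisson)
  \<comment> \<open>Mean 0 identifies this function as the normalized Hamiltonian of the curvature
    field, which is what \<open>inner_e\<close> integrates.\<close>
  have mean: "torus_integral (\<lambda>p. 1 / 4 * poisson g ?G p) = 0"
    unfolding torus_integral_cmult using g G(1) by (simp add: torus_integral_poisson)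
  have "inner_e (curvature0 (ham_vf f) (ham_vf g) (ham_vf g)) (ham_vf f)
      = torus_integral (\<lambda>p. 1 / 4 * poisson g ?G p * f p)"
    unfolding curvature0_ham_vf[OF f(1) g]
    by (rule inner_e_ham_vf[OF trig_poly.cmult[OF G(2)] mean f])
  also have "\<dots> = 1 / 4 * torus_integral (\<lambda>p. poisson g ?G p * f p)"
    unfolding mult.assoc by (rule torus_integral_cmult)
  also have "torus_integral (\<lambda>p. poisson g ?G p * f p) = - torus_integral (\<lambda>p. ?G p * poisson g f p)"
    by (rule torus_integral_poisson_by_parts[OF g G(1) f(1)])
  also have "\<dots> = - torus_integral (\<lambda>p. - 1 * (?G p)\<^sup>2)"
    by (simp add: poisson_swap[of g f] power2_eq_square)
  also have "\<dots> = torus_integral (\<lambda>p. (?G p)\<^sup>2)"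
    unfolding torus_integral_cmult by simp
  finally show ?thesis .
qed

section \<open>Independence of the basis of the plane\<close>

lemma poisson_lin_comb:
  assumes "trig_poly f" "trig_poly g"
  shows "poisson (\<lambda>p. a * f p + b * g p) (\<lambda>p. c * f p + d * g p) = (\<lambda>p. (a * d - b * c) * poisson f g p)"
  using assms poisson_swap[of g f]
  by (intro ext) (simp add: poisson_add_left poisson_add_right poisson_cmult_left poisson_cmult_right
      poisson_self trig_poly.intros algebra_simps)

lemma torus_integral_lin_comb_mult:
  assumes f: "trig_poly f" and g: "trig_poly g"
  shows "torus_integral (\<lambda>p. (a * f p + b * g p) * (c * f p + d * g p))
       = a * c * torus_integral (\<lambda>p. f p * f p) + (a * d + b * c) * torus_integral (\<lambda>p. f p * g p)
         + b * d * torus_integral (\<lambda>p. g p * g p)"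
proof -
  have cont: "continuous_on UNIV f" "continuous_on UNIV g"
    using assms by (simp_all add: trig_poly_continuous)
  have "(\<lambda>p. (a * f p + b * g p) * (c * f p + d * g p))
      = (\<lambda>p. (a * c * (f p * f p) + (a * d + b * c) * (f p * g p)) + b * d * (g p * g p))"
    by (simp add: algebra_simps)
  then have "torus_integral (\<lambda>p. (a * f p + b * g p) * (c * f p + d * g p))
      = torus_integral (\<lambda>p. a * c * (f p * f p) + (a * d + b * c) * (f p * g p))
        + torus_integral (\<lambda>p. b * d * (g p * g p))"
    by (simp only:) (intro torus_integral_add continuous_intros cont)
  moreover have "torus_integral (\<lambda>p. a * c * (f p * f p) + (a * d + b * c) * (f p * g p))
      = torus_integral (\<lambda>p. a * c * (f p * f p)) + torus_integral (\<lambda>p. (a * d + b * c) * (f p * g p))"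
    by (intro torus_integral_add continuous_intros cont)
  ultimately show ?thesis
    by (simp only: torus_integral_cmult)
qed

text \<open>Under a change of basis the numerator and the Gram determinant both scale by the squared
  determinant. Hence the quotient depends on the plane alone, and the description in
  \<open>sectional_curvature\<close> has a unique solution.\<close>

lemma sectional_curvature_span2:
  assumes f: "trig_poly f" "torus_integral f = 0" and g: "trig_poly g" "torus_integral g = 0"
    and indep: "lin_indep (ham_vf f) (ham_vf g)"
  shows "sectional_curvature (span2 (ham_vf f) (ham_vf g))
       = 1 / 4 * torus_integral (\<lambda>p. (poisson f g p)\<^sup>2)
         / (torus_integral (\<lambda>p. f p * f p) * torus_integral (\<lambda>p. g p * g p) - (torus_integral (\<lambda>p. f p * g p))\<^sup>2)"
    (is "_ = ?K")
proof -
  let ?quot = "\<lambda>X Y. inner_e (curvature0 X Y Y) X / (inner_e X X * inner_e Y Y - (inner_e X Y)\<^sup>2)"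
  define L where "L a b = (\<lambda>p. a * f p + b * g p)" for a b
  have L: "trig_poly (L a b)" for a b
    unfolding L_def by (intro trig_poly.add trig_poly.cmult f g)
  have intL: "torus_integral (L a b) = 0" for a b
  proof -
    have "torus_integral (L a b) = torus_integral (\<lambda>p. a * f p) + torus_integral (\<lambda>p. b * g p)"
      unfolding L_def by (intro torus_integral_add trig_poly_continuous trig_poly.cmult f g)
    then show ?thesis
      by (simp add: torus_integral_cmult f g)
  qed
  have vf_L: "ham_vf (L a b) = (\<lambda>p. a *\<^sub>R ham_vf f p + b *\<^sub>R ham_vf g p)" for a b
    unfolding L_def
    by (simp only: trig_poly_ham_vf_add[OF trig_poly.cmult trig_poly.cmult, OF f(1) g(1)]
        trig_poly_ham_vf_cmult[OF f(1)] trig_poly_ham_vf_cmult[OF g(1)])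
  have quot: "?quot (ham_vf (L a b)) (ham_vf (L c d)) = ?K" if "a * d - b * c \<noteq> 0" for a b c d
  proof -
    have "torus_integral (\<lambda>p. (poisson (L a b) (L c d) p)\<^sup>2) = (a * d - b * c)\<^sup>2 * torus_integral (\<lambda>p. (poisson f g p)\<^sup>2)"
      unfolding L_def poisson_lin_comb[OF f(1) g(1)] power_mult_distrib by (rule torus_integral_cmult)
    moreover have "inner_e (ham_vf (L a b)) (ham_vf (L c d))
       = a * c * torus_integral (\<lambda>p. f p * f p) + (a * d + b * c) * torus_integral (\<lambda>p. f p * g p)
         + b * d * torus_integral (\<lambda>p. g p * g p)" for a b c d
      unfolding inner_e_ham_vf[OF L intL L intL] unfolding L_def by (rule torus_integral_lin_comb_mult[OF f(1) g(1)])
    ultimately have "?quot (ham_vf (L a b)) (ham_vf (L c d))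
       = (a * d - b * c)\<^sup>2 * (1 / 4 * torus_integral (\<lambda>p. (poisson f g p)\<^sup>2))
       / ((a * d - b * c)\<^sup>2 * (torus_integral (\<lambda>p. f p * f p) * torus_integral (\<lambda>p. g p * g p) - (torus_integral (\<lambda>p. f p * g p))\<^sup>2))"
      by (simp only: inner_e_curvature0[OF L intL L]) (simp add: power2_eq_square algebra_simps)
    also have "\<dots> = ?K"
      by (rule mult_divide_mult_cancel_left) (use that in simp)
    finally show ?thesis .
  qed
  have L_eq: "f = L 1 0" "g = L 0 1"
    by (simp_all add: L_def)
  have mem: "ham_vf f \<in> ham_fields" "ham_vf g \<in> ham_fields"
    using f g by (auto simp: ham_fields_def trig_poly_normalized)
  show ?thesis
    unfolding sectional_curvature_def
  proof (rule the_equality)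
    show "\<forall>X\<in>ham_fields. \<forall>Y\<in>ham_fields. lin_indep X Y \<and> span2 X Y = span2 (ham_vf f) (ham_vf g) \<longrightarrow> ?K = ?quot X Y"
    proof (intro ballI impI, elim conjE)
      fix X Y
      assume XY: "lin_indep X Y" "span2 X Y = span2 (ham_vf f) (ham_vf g)"
      have "X = (\<lambda>p. 1 *\<^sub>R X p + 0 *\<^sub>R Y p)" "Y = (\<lambda>p. 0 *\<^sub>R X p + 1 *\<^sub>R Y p)"
        by simp_all
      then have "X \<in> span2 X Y" "Y \<in> span2 X Y"
        unfolding span2_def by blast+
      then obtain a b c d where X: "X = ham_vf (L a b)" and Y: "Y = ham_vf (L c d)"
        by (simp only: XY(2)) (unfold span2_def vf_L, blast)
      have "a * d - b * c \<noteq> 0"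
      proof
        assume D: "a * d - b * c = 0"
        \<comment> \<open>Cramer's rule: the adjugate matrix recovers the original basis up to the
          determinant. If that is 0, independence of \<open>X\<close> and \<open>Y\<close> makes all
          four coefficients 0, so \<open>X\<close> vanishes, a contradiction.\<close>
        have "d *\<^sub>R X p + (- b) *\<^sub>R Y p = (a * d - b * c) *\<^sub>R ham_vf f p"
          "(- c) *\<^sub>R X p + a *\<^sub>R Y p = (a * d - b * c) *\<^sub>R ham_vf g p" for p
          by (simp_all add: X Y vf_L algebra_simps)
        then have "\<forall>p. d *\<^sub>R X p + (- b) *\<^sub>R Y p = 0" "\<forall>p. (- c) *\<^sub>R X p + a *\<^sub>R Y p = 0"
          unfolding D by simp_all
        then have "d = 0 \<and> - b = 0" "- c = 0 \<and> a = 0"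
          using XY(1) unfolding lin_indep_def by blast+
        then have "1 *\<^sub>R X p + 0 *\<^sub>R Y p = 0" for p
          by (simp add: X vf_L)
        then show False
          using XY(1) unfolding lin_indep_def by (metis zero_neq_one)
      qed
      then show "?K = ?quot X Y"
        unfolding X Y using quot by simp
    qed
  next
    fix K
    assume "\<forall>X\<in>ham_fields. \<forall>Y\<in>ham_fields. lin_indep X Y \<and> span2 X Y = span2 (ham_vf f) (ham_vf g) \<longrightarrow> K = ?quot X Y"
    \<comment> \<open>Uniqueness needs one admissible basis, and the given pair is one.\<close>
    then have "K = ?quot (ham_vf f) (ham_vf g)"
      using mem indep by blast
    then show "K = ?K"
      \<comment> \<open>The variables of \<open>quot\<close> are filled in the order
        \<open>a\<close>, \<open>d\<close>, \<open>b\<close>, \<open>c\<close> of its premise, so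
        this is the identity matrix.\<close>
      using quot[of 1 1 0 0] by (simp flip: L_eq)
  qed
qed

section \<open>Explicit integrals for two harmonics\<close>

lemma torus_integral_harmonic_mult:
  fixes n m k l :: "int ^ 'q::finite"
  shows "torus_integral (\<lambda>p. cos (phase n m p + s) * cos (phase k l p + t))
       = (2 * pi) ^ (2 * CARD('q)) / 2 *
          ((if freq n m = freq k l then cos (s - t) else 0) + (if freq n m = - freq k l then cos (s + t) else 0))"
proof -
  \<comment> \<open>Both conditions can hold together, namely at frequency 0, hence two separate
    summands in the result.\<close>
  have *: "freq (n - k) (m - l) = 0 \<longleftrightarrow> freq n m = freq k l" "freq (n + k) (m + l) = 0 \<longleftrightarrow> freq n m = - freq k l"
    by (simp_all add: freq_simps(1,2) eq_neg_iff_add_eq_0)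
  let ?d = "\<lambda>p. cos (phase (n - k) (m - l) p + (s - t))"
  let ?e = "\<lambda>p. cos (phase (n + k) (m + l) p + (s + t))"
  have "(\<lambda>p. cos (phase n m p + s) * cos (phase k l p + t)) = (\<lambda>p. 1 / 2 * (?d p + ?e p))"
    by (rule ext) (simp add: phase_shift_simps cos_times_cos)
  then have "torus_integral (\<lambda>p. cos (phase n m p + s) * cos (phase k l p + t)) = 1 / 2 * torus_integral (\<lambda>p. ?d p + ?e p)"
    by (simp only: torus_integral_cmult)
  also have "torus_integral (\<lambda>p. ?d p + ?e p) = torus_integral ?d + torus_integral ?e"
    by (intro torus_integral_add trig_poly_continuous trig_poly.harmonic)
  finally show ?thesis
    unfolding torus_integral_harmonic * by (simp add: algebra_simps)
qed

lemma self_neq_uminus: "u \<noteq> 0 \<Longrightarrow> u \<noteq> - u" for u :: "'a::real_vector"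
  using scaleR_2[of u] by (auto simp: eq_neg_iff_add_eq_0)

text \<open>If the pairing is nonzero, the difference and the sum of the frequencies are nonzero and
  distinct up to sign. The two cosines in the bracket are then orthogonal, each with mean square
  1/2.\<close>

lemma torus_integral_poisson_harmonic_square:
  fixes n m k l :: "int ^ 'q::finite"
  shows "torus_integral (\<lambda>p. (poisson (\<lambda>p. cos (phase n m p + s)) (\<lambda>p. cos (phase k l p + t)) p)\<^sup>2)
       = (rot (freq n m) \<bullet> freq k l)\<^sup>2 / 4 * (2 * pi) ^ (2 * CARD('q))"
proof (cases "rot (freq n m) \<bullet> freq k l = 0")
  case True
  then show ?thesis
    by (simp add: poisson_harmonic torus_integral_const)
next
  case False
  define c where "c = rot (freq n m) \<bullet> freq k l"
  let ?d = "\<lambda>p. cos (phase (n - k) (m - l) p + (s - t))"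
  let ?e = "\<lambda>p. cos (phase (n + k) (m + l) p + (s + t))"
  have nz: "freq n m \<noteq> 0" "freq k l \<noteq> 0" "freq n m \<noteq> freq k l" "freq n m \<noteq> - freq k l"
    using False rot_inner_self[of "freq k l"] rot_scaleR[of "-1" "freq k l"] rot_scaleR[of 0 "freq k l"] by auto
  have "(\<lambda>p. (poisson (\<lambda>p. cos (phase n m p + s)) (\<lambda>p. cos (phase k l p + t)) p)\<^sup>2)
      = (\<lambda>p. (c / 2)\<^sup>2 * ((1 * ?d p + - 1 * ?e p) * (1 * ?d p + - 1 * ?e p)))"
    unfolding poisson_harmonic' c_def[symmetric] by (simp add: power2_eq_square algebra_simps)
  then have "torus_integral (\<lambda>p. (poisson (\<lambda>p. cos (phase n m p + s)) (\<lambda>p. cos (phase k l p + t)) p)\<^sup>2)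
      = (c / 2)\<^sup>2 * torus_integral (\<lambda>p. (1 * ?d p + - 1 * ?e p) * (1 * ?d p + - 1 * ?e p))"
    by (simp only: torus_integral_cmult)
  also have "torus_integral (\<lambda>p. (1 * ?d p + - 1 * ?e p) * (1 * ?d p + - 1 * ?e p)) = (2 * pi) ^ (2 * CARD('q))"
  proof -
    \<comment> \<open>The last two inequalities amount to \<open>v \<noteq> - v\<close> and
      \<open>u \<noteq> - u\<close>.\<close>
    have "u - v \<noteq> - (u - v)" "u + v \<noteq> - (u + v)" "u - v \<noteq> u + v" "u - v \<noteq> - (u + v)"
      if "u \<noteq> 0" "v \<noteq> 0" "u \<noteq> v" "u \<noteq> - v" for u v :: "'q pt"
      using that self_neq_uminus[of "u - v"] self_neq_uminus[of "u + v"] self_neq_uminus[of u] self_neq_uminus[of v]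
      by (auto simp: algebra_simps eq_neg_iff_add_eq_0)
    from this[OF nz] show ?thesis
      unfolding torus_integral_lin_comb_mult[OF trig_poly.harmonic trig_poly.harmonic]
        torus_integral_harmonic_mult freq_simps by simp
  qed
  finally show ?thesis
    by (simp add: c_def power_divide)
qed

text \<open>Brings all four choices of \<open>F\<close> and \<open>H\<close> into the form of a
  shifted cosine; the shift \<open>- (pi / 2)\<close> gives the sine.\<close>

lemma cos_sin_phase_cases:
  assumes "F \<in> {\<lambda>p. cos (phase n m p), \<lambda>p. sin (phase n m p)}"
  obtains s where "F = (\<lambda>p. cos (phase n m p + s))" "s = 0 \<or> s = - (pi / 2)"
proof (cases "F = (\<lambda>p. cos (phase n m p))")
  case True
  then show ?thesis using that[of 0] by simp
next
  case False
  then have "F = (\<lambda>p. cos (phase n m p + - (pi / 2)))"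
    using assms by (simp add: cos_diff)
  then show ?thesis using that[of "- (pi / 2)"] by simp
qed

theorem mainTheorem4:
  fixes n m k l :: "int ^ 'q::finite"
    and F H :: "'q pt \<Rightarrow> real"
    and \<sigma> :: "('q pt \<Rightarrow> 'q pt) set"
  assumes "zdot n n + zdot m m \<noteq> 0"
    and "zdot k k + zdot l l \<noteq> 0"
    and "F \<in> {\<lambda>p. cos (phase n m p), \<lambda>p. sin (phase n m p)}"
    and "H \<in> {\<lambda>p. cos (phase k l p), \<lambda>p. sin (phase k l p)}"
    and "lin_indep (ham_vf F) (ham_vf H)"
    and "\<sigma> = span2 (ham_vf F) (ham_vf H)"
  shows "sectional_curvature \<sigma> =
           of_int ((zdot m k - zdot n l)\<^sup>2) / (4 * (2 * pi) ^ (2 * CARD('q)))"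
proof -
  define V where "V = (2 * pi) ^ (2 * CARD('q))"
  have "V > 0" by (simp add: V_def)
  obtain s where F: "F = (\<lambda>p. cos (phase n m p + s))" and s: "s = 0 \<or> s = - (pi / 2)"
    using assms(3) by (rule cos_sin_phase_cases)
  obtain t where H: "H = (\<lambda>p. cos (phase k l p + t))" and t: "t = 0 \<or> t = - (pi / 2)"
    using assms(4) by (rule cos_sin_phase_cases)
  have u: "freq n m \<noteq> 0" and v: "freq k l \<noteq> 0"
    using assms(1,2) by (auto simp: freq_simps zdot_def)
  have trig: "trig_poly F" "trig_poly H"
    unfolding F H by (rule trig_poly.harmonic)+
  have mean: "torus_integral F = 0" "torus_integral H = 0"
    using u v by (simp_all add: F H torus_integral_harmonic)
  \<comment> \<open>The form in which linear independence enters the orthogonality argument, with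
    \<open>\<epsilon>\<close> equal to 1 or -1.\<close>
  have not_multiple: "F \<noteq> (\<lambda>p. \<epsilon> * H p)" for \<epsilon>
  proof
    assume "F = (\<lambda>p. \<epsilon> * H p)"
    then have "ham_vf F = (\<lambda>p. \<epsilon> *\<^sub>R ham_vf H p)"
      by (simp only: trig_poly_ham_vf_cmult[OF trig(2)])
    then have "\<forall>p. 1 *\<^sub>R ham_vf F p + (- \<epsilon>) *\<^sub>R ham_vf H p = 0"
      by simp
    then have "(1::real) = 0"
      using assms(5) unfolding lin_indep_def by blast
    then show False by simp
  qed
  \<comment> \<open>Only frequencies equal up to sign could contribute. There independence forces
    \<open>s \<noteq> t\<close>, so one function is a cosine and the other a sine, and the remaining
    cosine of the shifts is 0.\<close>
  have FH: "torus_integral (\<lambda>p. F p * H p) = 0"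
  proof -
    have "cos (s - t) = 0" if "freq n m = freq k l"
    proof -
      have "s \<noteq> t"
        using that not_multiple[of 1] by (auto simp: F H phase_eq_inner)
      with s t show ?thesis by (auto simp: cos_minus)
    qed
    moreover have "cos (s + t) = 0" if "freq n m = - freq k l"
    proof -
      \<comment> \<open>For opposite frequencies two cosines coincide, while two sines are negatives
        of each other.\<close>
      have "F p = H p" if "s = 0" "t = 0" for p
        using that \<open>freq n m = - freq k l\<close> by (simp add: F H phase_eq_inner)
      moreover have "F p = - 1 * H p" if "s = - (pi / 2)" "t = - (pi / 2)" for p
        using that \<open>freq n m = - freq k l\<close> by (simp add: F H phase_eq_inner cos_diff)
      ultimately have "s \<noteq> t"
        using s t not_multiple[of 1] not_multiple[of "- 1"] by (metis ext mult_1)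
      with s t show ?thesis by auto
    qed
    ultimately show ?thesis
      by (simp add: F H torus_integral_harmonic_mult)
  qed
  \<comment> \<open>A nonzero frequency differs from its negative, so only the term with
    \<open>cos 0\<close> survives.\<close>
  have FF: "torus_integral (\<lambda>p. F p * F p) = V / 2" and HH: "torus_integral (\<lambda>p. H p * H p) = V / 2"
    using self_neq_uminus[OF u] self_neq_uminus[OF v]
    by (simp_all add: F H torus_integral_harmonic_mult V_def)
  have "torus_integral (\<lambda>p. (poisson F H p)\<^sup>2) = (of_int (zdot n l - zdot m k))\<^sup>2 / 4 * V"
    unfolding F H torus_integral_poisson_harmonic_square rot_inner V_def ..
  then have "sectional_curvature \<sigma> = 1 / 4 * ((of_int (zdot n l - zdot m k))\<^sup>2 / 4 * V) / (V / 2 * (V / 2) - 0\<^sup>2)"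
    unfolding assms(6) sectional_curvature_span2[OF trig(1) mean(1) trig(2) mean(2) assms(5)] FF HH FH
    by (simp only:)
  also have "\<dots> = (of_int (zdot m k - zdot n l))\<^sup>2 / (4 * V)"
    using \<open>V > 0\<close> by (simp add: field_simps power2_eq_square)
  finally show ?thesis
    by (simp add: V_def)
qed

end
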